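(* Let $0\le\lambda_0<\lambda_1<\cdots$ be a real sequence with $\lambda_n\to\infty$, let $(u_n)_{n\ge 0}$ be a sequence of fuzzy numbers and let $\mu$ be a fuzzy number. Suppose that $\sum u_n$ is $(A,\lambda)$ summable to $\mu$, i.e. the generalized Dirichlet series $\sum_{n=0}^\infty u_ne^{-\lambda_ns}$ converges for every $s>0$ and $\lim_{s\to0^+}\sum_{n=0}^\infty u_ne^{-\lambda_ns}=\mu$. If $$\frac{\lambda_n}{\lambda_n-\lambda_{n-1}}D(u_n,\bar 0)=o(1)\qquad(n\to\infty),$$ then $\sum_{n=0}^\infty u_n=\mu$.
   Context: A fuzzy number is a function $u:\mathbb{R}\to[0,1]$ that is normal ($u(t_0)=1$ for some $t_0$), fuzzy convex ($u(\theta t+(1-\theta)t')\ge\min\{u(t),u(t')\}$ for all $t,t'\in\mathbb{R}$, $\theta\in[0,1]$), upper semicontinuous, and has compact support $\overline{\{t\in\mathbb{R}:u(t)>0\}}$. $\mathbb{R}_{\mathcal{F}}$ denotes the set of fuzzy numbers. The $\alpha$-level sets are $[u]_\alpha=\{t:u(t)\ge\alpha\}$ for $0<\alpha\le1$ and $[u]_0=\overline{\{t:u(t)>0\}}$; they are compact intervals, written $[u]_\alpha=[u^-_\alpha,u^+_\alpha]$. The fuzzy number $\bar 0$ is given by $\bar0(0)=1$ and $\bar0(t)=0$ for $t\ne0$. Operations are levelwise: $[u+v]_\alpha=[u^-_\alpha+v^-_\alpha,u^+_\alpha+v^+_\alpha]$, and for $k\in\mathbb{R}$, $[ku]_\alpha=[ku^-_\alpha,ku^+_\alpha]$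 if $k\ge0$ and $[ku]_\alpha=[ku^+_\alpha,ku^-_\alpha]$ if $k<0$. The expression $u_nc$ with $c\in\mathbb{R}$ means the scalar multiple $cu_n$. The metric on $\mathbb{R}_{\mathcal{F}}$ is $D(u,v)=\sup_{\alpha\in[0,1]}\max\{|u^-_\alpha-v^-_\alpha|,|u^+_\alpha-v^+_\alpha|\}$. All limits of fuzzy numbers are with respect to $D$. A series $\sum u_n$ of fuzzy numbers converges to $u\in\mathbb{R}_{\mathcal{F}}$ (written $\sum u_n=u$) if its partial sums converge to $u$ in $D$. *)

theory Defs
  imports "HOL-Analysis.Analysis" "HOL-Library.Landau_Symbols"
begin

section \<open>Fuzzy numbers\<close>

text \<open>The fourth conjunct is upper semicontinuity on the real line.\<close>

definition is_fuzzy_number :: "(real \<Rightarrow> real) \<Rightarrow> bool" where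
  "is_fuzzy_number u \<longleftrightarrow>
     range u \<subseteq> {0..1} \<and>
     (\<exists>t. u t = 1) \<and>
     (\<forall>t t' \<theta>. 0 \<le> \<theta> \<and> \<theta> \<le> 1 \<longrightarrow> u (\<theta> * t + (1 - \<theta>) * t') \<ge> min (u t) (u t')) \<and>
     (\<forall>t y. u t < y \<longrightarrow> (\<forall>\<^sub>F t' in nhds t. u t' < y)) \<and>
     compact (closure {t. u t > 0})"

lemma is_fuzzy_number_indicator: "is_fuzzy_number (indicator {c})"
proof -
  have "\<forall>\<^sub>F t' in nhds t. indicator {c} t' < y" if "indicator {c} t < y" for t y :: real
  proof (cases "t = c")
    case True
    then have "indicator {c} t' < y" for t' :: real
      using that by (auto simp: indicator_def)
    then show ?thesis by simp
  next
    case False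
    then have "\<forall>\<^sub>F t' in nhds t. t' \<in> - {c}"
      by (intro eventually_nhds_in_open) auto
    then show ?thesis
      by eventually_elim (use that False in \<open>auto simp: indicator_def\<close>)
  qed
  moreover have "{t. indicator {c} t > (0::real)} = {c}"
    by (auto simp: indicator_def)
  moreover have "\<theta> * c + (1 - \<theta>) * c = c" for \<theta> :: real
    by (simp add: algebra_simps)
  ultimately show ?thesis
    unfolding is_fuzzy_number_def
    by (auto simp: indicator_def)
qed

typedef fuzzy_number = "{u. is_fuzzy_number u}"
  morphisms membership Abs_fuzzy_number
  using is_fuzzy_number_indicator by blast

text \<open>Only the values \<open>\<alpha> \<in> {0..1}\<close> are meaningful in the next three definitions.\<close>

definition level :: "fuzzy_number \<Rightarrow> real \<Rightarrow> real set" where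
  "level u \<alpha> = (if \<alpha> = 0 then closure {t. membership u t > 0} else {t. membership u t \<ge> \<alpha>})"

definition lower :: "fuzzy_number \<Rightarrow> real \<Rightarrow> real" where
  "lower u \<alpha> = Inf (level u \<alpha>)"

definition upper :: "fuzzy_number \<Rightarrow> real \<Rightarrow> real" where
  "upper u \<alpha> = Sup (level u \<alpha>)"

lemma fuzzy_number_eqI:
  assumes "\<And>\<alpha>. \<alpha> \<in> {0..1} \<Longrightarrow> level u \<alpha> = level v \<alpha>"
  shows "u = v"
proof -
  have fu: "is_fuzzy_number (membership u)" for u
    using membership by auto
  have *: "membership v t \<le> membership u t"
    if lv: "\<And>\<alpha>. \<alpha> \<in> {0..1} \<Longrightarrow> level u \<alpha> = level v \<alpha>" for u v t
  proof (rule ccontr)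
    assume "\<not> ?thesis"
    then have less: "membership u t < membership v t" by simp
    have r: "membership u t \<in> {0..1}" "membership v t \<in> {0..1}"
      using fu unfolding is_fuzzy_number_def by blast+
    have "t \<in> level v (membership v t)"
      using less r by (auto simp: level_def)
    then have "t \<in> level u (membership v t)"
      using lv r by blast
    then show False using less r by (auto simp: level_def)
  qed
  have "membership u = membership v"
    using *[of u v] *[of v u] assms by (intro ext antisym) auto
  then show ?thesis by (simp add: membership_inject)
qed

lemma level_props:
  assumes "\<alpha> \<in> {0..1}"
  shows "level u \<alpha> \<noteq> {}" "compact (level u \<alpha>)" "convex (level u \<alpha>)"
proof -
  let ?m = "membership u"
  have f: "is_fuzzy_number ?m" using membership by auto
  obtain t where t: "?m t = 1" using f by (auto simp: is_fuzzy_number_def)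
  have tl: "t \<in> level u \<alpha>"
    using assms t closure_subset[of "{t. ?m t > 0}"] by (auto simp: level_def)
  then show "level u \<alpha> \<noteq> {}" by blast
  have qc: "?m (a * x + b * y) \<ge> min (?m x) (?m y)" if "0 \<le> a" "0 \<le> b" "a + b = 1" for a b x y
  proof -
    have "b = 1 - a" "a \<le> 1" using that by auto
    then show ?thesis using f that unfolding is_fuzzy_number_def by blast
  qed
  have c0: "convex {t. ?m t > 0}"
  proof (rule convexI)
    fix x y a b :: real
    assume "x \<in> {t. ?m t > 0}" "y \<in> {t. ?m t > 0}" "0 \<le> a" "0 \<le> b" "a + b = 1"
    then show "a *\<^sub>R x + b *\<^sub>R y \<in> {t. ?m t > 0}"
      using qc[of a b x y] by auto
  qed
  have c1: "convex {t. ?m t \<ge> \<alpha>}"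
  proof (rule convexI)
    fix x y a b :: real
    assume "x \<in> {t. ?m t \<ge> \<alpha>}" "y \<in> {t. ?m t \<ge> \<alpha>}" "0 \<le> a" "0 \<le> b" "a + b = 1"
    then show "a *\<^sub>R x + b *\<^sub>R y \<in> {t. ?m t \<ge> \<alpha>}"
      using qc[of a b x y] by auto
  qed
  show "convex (level u \<alpha>)"
    using c0 c1 by (simp add: level_def convex_closure)
  show "compact (level u \<alpha>)"
  proof (cases "\<alpha> = 0")
    case True
    then show ?thesis using f by (simp add: level_def is_fuzzy_number_def)
  next
    case False
    have "open {t. ?m t < \<alpha>}"
    proof (subst open_subopen, intro ballI)
      fix x assume "x \<in> {t. ?m t < \<alpha>}"
      then have "\<forall>\<^sub>F t' in nhds x. ?m t' < \<alpha>"
        using f by (auto simp: is_fuzzy_number_def)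
      then show "\<exists>T. open T \<and> x \<in> T \<and> T \<subseteq> {t. ?m t < \<alpha>}"
        unfolding eventually_nhds by blast
    qed
    moreover have "{t. ?m t \<ge> \<alpha>} = - {t. ?m t < \<alpha>}" by auto
    ultimately have cl: "closed {t. ?m t \<ge> \<alpha>}" by (simp add: closed_def)
    have sub: "{t. ?m t \<ge> \<alpha>} \<subseteq> closure {t. ?m t > 0}"
      using False assms closure_subset[of "{t. ?m t > 0}"] by force
    have "compact (closure {t. ?m t > 0})" using f by (simp add: is_fuzzy_number_def)
    from compact_Int_closed[OF this cl] sub
    have "compact {t. ?m t \<ge> \<alpha>}" by (simp add: Int_absorb1)
    then show ?thesis using False by (simp add: level_def)
  qed
qed

lemma level_eq_interval:
  assumes "\<alpha> \<in> {0..1}"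
  shows "level u \<alpha> = {lower u \<alpha>..upper u \<alpha>}" "lower u \<alpha> \<le> upper u \<alpha>"
proof -
  have "connected (level u \<alpha>)"
    using level_props(3)[OF assms] by (rule convex_connected)
  then obtain a b where ab: "level u \<alpha> = {a..b}"
    using level_props(2)[OF assms, of u] connected_compact_interval_1 by blast
  have "a \<le> b" using ab level_props(1)[OF assms, of u] by auto
  then show "level u \<alpha> = {lower u \<alpha>..upper u \<alpha>}" "lower u \<alpha> \<le> upper u \<alpha>"
    using ab by (auto simp: lower_def upper_def)
qed

lemma level_antimono:
  assumes "0 \<le> \<alpha>" "\<alpha> \<le> \<beta>"
  shows "level u \<beta> \<subseteq> level u \<alpha>"
proof (cases "\<alpha> = 0 \<and> \<beta> > 0")
  case True
  then have "{t. membership u t \<ge> \<beta>} \<subseteq> {t. membership u t > 0}" by auto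
  then show ?thesis
    using True closure_subset[of "{t. membership u t > 0}"] by (auto simp: level_def)
next
  case False
  then show ?thesis using assms by (auto simp: level_def)
qed

lemma lower_upper_mono:
  assumes "0 \<le> \<alpha>" "\<alpha> \<le> \<beta>" "\<beta> \<le> 1"
  shows "lower u \<alpha> \<le> lower u \<beta>" "upper u \<beta> \<le> upper u \<alpha>"
  using level_antimono[OF assms(1,2), of u] assms level_eq_interval[of \<alpha> u] level_eq_interval[of \<beta> u]
  by auto

lemma level_left_limit:
  assumes "0 < \<alpha>" "\<alpha> \<le> 1" "\<And>\<beta>. 0 < \<beta> \<Longrightarrow> \<beta> < \<alpha> \<Longrightarrow> t \<in> level u \<beta>"
  shows "t \<in> level u \<alpha>"
proof -
  have "\<beta> \<le> membership u t" if "0 < \<beta>" "\<beta> < \<alpha>" for \<beta>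
    using assms(3)[OF that] that by (simp add: level_def)
  then have "\<alpha> \<le> membership u t"
    using assms(1) by (intro dense_le_bounded[of 0 \<alpha>]) auto
  then show ?thesis using assms by (simp add: level_def)
qed

lemma lower_upper_at_left:
  assumes a: "0 < \<alpha>" "\<alpha> \<le> 1"
  shows "(lower u \<longlongrightarrow> lower u \<alpha>) (at_left \<alpha>)" "(upper u \<longlongrightarrow> upper u \<alpha>) (at_left \<alpha>)"
proof -
  have ev: "\<forall>\<^sub>F x in at_left \<alpha>. \<beta> < x \<and> x < \<alpha>" if "\<beta> < \<alpha>" for \<beta>
    using eventually_at_left_real[OF that] by (rule eventually_mono) auto
  show "(lower u \<longlongrightarrow> lower u \<alpha>) (at_left \<alpha>)"
  proof (rule order_tendstoI)
    fix y assume y: "y < lower u \<alpha>"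
    have "\<exists>\<beta>. 0 < \<beta> \<and> \<beta> < \<alpha> \<and> y < lower u \<beta>"
    proof (rule ccontr)
      assume n: "\<not> ?thesis"
      have "y \<in> level u \<beta>" if "0 < \<beta>" "\<beta> < \<alpha>" for \<beta>
      proof -
        have "lower u \<beta> \<le> y" using n that by force
        moreover have "upper u \<alpha> \<le> upper u \<beta>" using lower_upper_mono that a by auto
        moreover have "lower u \<alpha> \<le> upper u \<alpha>" using level_eq_interval a by auto
        ultimately show ?thesis using y that a level_eq_interval(1)[of \<beta> u] by auto
      qed
      then have "y \<in> level u \<alpha>" using level_left_limit a by blast
      then show False using y a level_eq_interval(1)[of \<alpha> u] by auto
    qed
    then obtain \<beta> where b: "0 < \<beta>" "\<beta> < \<alpha>" "y < lower u \<beta>" by blast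
    show "\<forall>\<^sub>F x in at_left \<alpha>. y < lower u x"
      using ev[OF b(2)]
    proof eventually_elim
      case (elim x)
      then show ?case using lower_upper_mono(1)[of \<beta> x u] a b by auto
    qed
  next
    fix y assume y: "lower u \<alpha> < y"
    show "\<forall>\<^sub>F x in at_left \<alpha>. lower u x < y"
      using ev[OF a(1)]
    proof eventually_elim
      case (elim x)
      then show ?case using lower_upper_mono(1)[of x \<alpha> u] a y by auto
    qed
  qed
  show "(upper u \<longlongrightarrow> upper u \<alpha>) (at_left \<alpha>)"
  proof (rule order_tendstoI)
    fix y assume y: "upper u \<alpha> < y"
    have "\<exists>\<beta>. 0 < \<beta> \<and> \<beta> < \<alpha> \<and> upper u \<beta> < y"
    proof (rule ccontr)
      assume n: "\<not> ?thesis"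
      have "y \<in> level u \<beta>" if "0 < \<beta>" "\<beta> < \<alpha>" for \<beta>
      proof -
        have "y \<le> upper u \<beta>" using n that by force
        moreover have "lower u \<beta> \<le> lower u \<alpha>" using lower_upper_mono that a by auto
        moreover have "lower u \<alpha> \<le> upper u \<alpha>" using level_eq_interval a by auto
        ultimately show ?thesis using y that a level_eq_interval(1)[of \<beta> u] by auto
      qed
      then have "y \<in> level u \<alpha>" using level_left_limit a by blast
      then show False using y a level_eq_interval(1)[of \<alpha> u] by auto
    qed
    then obtain \<beta> where b: "0 < \<beta>" "\<beta> < \<alpha>" "upper u \<beta> < y" by blast
    show "\<forall>\<^sub>F x in at_left \<alpha>. upper u x < y"
      using ev[OF b(2)]
    proof eventually_elim
      case (elim x)
      then show ?case using lower_upper_mono(2)[of \<beta> x u] a b by auto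
    qed
  next
    fix y assume y: "y < upper u \<alpha>"
    show "\<forall>\<^sub>F x in at_left \<alpha>. y < upper u x"
      using ev[OF a(1)]
    proof eventually_elim
      case (elim x)
      then show ?case using lower_upper_mono(2)[of x \<alpha> u] a y by auto
    qed
  qed
qed

lemma level_zero_approx:
  assumes "t \<in> level u 0" "open S" "t \<in> S"
  shows "\<exists>\<beta> x. 0 < \<beta> \<and> \<beta> \<le> 1 \<and> x \<in> S \<and> x \<in> level u \<beta>"
proof -
  have "S \<inter> {t. membership u t > 0} \<noteq> {}"
    using assms by (auto simp: level_def closure_iff_nhds_not_empty)
  then obtain x where x: "x \<in> S" "membership u x > 0" by blast
  have "membership u x \<le> 1"
    using membership[of u] unfolding is_fuzzy_number_def by (auto simp: image_subset_iff)
  with x show ?thesis by (intro exI[of _ "membership u x"] exI[of _ x]) (auto simp: level_def)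
qed

lemma lower_upper_at_right_0:
  "(lower u \<longlongrightarrow> lower u 0) (at_right 0)" "(upper u \<longlongrightarrow> upper u 0) (at_right 0)"
proof -
  have ev: "\<forall>\<^sub>F x in at_right 0. 0 < x \<and> x < \<beta>" if "0 < \<beta>" for \<beta> :: real
    using eventually_at_right_real[OF that] by (rule eventually_mono) auto
  have i0: "level u 0 = {lower u 0..upper u 0}" "lower u 0 \<le> upper u 0"
    using level_eq_interval[of 0 u] by auto
  show "(lower u \<longlongrightarrow> lower u 0) (at_right 0)"
  proof (rule order_tendstoI)
    fix y assume y: "y < lower u 0"
    show "\<forall>\<^sub>F x in at_right 0. y < lower u x"
      using ev[of 1, simplified]
    proof eventually_elim
      case (elim x)
      then show ?case using lower_upper_mono(1)[of 0 x u] y by auto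
    qed
  next
    fix y assume y: "lower u 0 < y"
    obtain \<beta> x where b: "0 < \<beta>" "\<beta> \<le> 1" "x < y" "x \<in> level u \<beta>"
      using level_zero_approx[of "lower u 0" u "{..<y}"] i0 y by auto
    then have "lower u \<beta> < y" using level_eq_interval(1)[of \<beta> u] by auto
    show "\<forall>\<^sub>F x in at_right 0. lower u x < y"
      using ev[OF b(1)]
    proof eventually_elim
      case (elim x)
      then show ?case using lower_upper_mono(1)[of x \<beta> u] b \<open>lower u \<beta> < y\<close> by auto
    qed
  qed
  show "(upper u \<longlongrightarrow> upper u 0) (at_right 0)"
  proof (rule order_tendstoI)
    fix y assume y: "upper u 0 < y"
    show "\<forall>\<^sub>F x in at_right 0. upper u x < y"
      using ev[of 1, simplified]
    proof eventually_elim
      case (elim x)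
      then show ?case using lower_upper_mono(2)[of 0 x u] y by auto
    qed
  next
    fix y assume y: "y < upper u 0"
    obtain \<beta> x where b: "0 < \<beta>" "\<beta> \<le> 1" "y < x" "x \<in> level u \<beta>"
      using level_zero_approx[of "upper u 0" u "{y<..}"] i0 y by auto
    then have "y < upper u \<beta>" using level_eq_interval(1)[of \<beta> u] by auto
    show "\<forall>\<^sub>F x in at_right 0. y < upper u x"
      using ev[OF b(1)]
    proof eventually_elim
      case (elim x)
      then show ?case using lower_upper_mono(2)[of x \<beta> u] b \<open>y < upper u \<beta>\<close> by auto
    qed
  qed
qed

text \<open>The Goetschel--Voxman representation theorem: which interval families are level families.\<close>

lemma ex_fuzzy_number_of_levels:
  fixes a b :: "real \<Rightarrow> real"
  assumes a_mono: "\<And>\<alpha> \<beta>. 0 \<le> \<alpha> \<Longrightarrow> \<alpha> \<le> \<beta> \<Longrightarrow> \<beta> \<le> 1 \<Longrightarrow> a \<alpha> \<le> a \<beta>"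
    and b_anti: "\<And>\<alpha> \<beta>. 0 \<le> \<alpha> \<Longrightarrow> \<alpha> \<le> \<beta> \<Longrightarrow> \<beta> \<le> 1 \<Longrightarrow> b \<beta> \<le> b \<alpha>"
    and ab: "a 1 \<le> b 1"
    and a_left: "\<And>\<alpha>. 0 < \<alpha> \<Longrightarrow> \<alpha> \<le> 1 \<Longrightarrow> (a \<longlongrightarrow> a \<alpha>) (at_left \<alpha>)"
    and b_left: "\<And>\<alpha>. 0 < \<alpha> \<Longrightarrow> \<alpha> \<le> 1 \<Longrightarrow> (b \<longlongrightarrow> b \<alpha>) (at_left \<alpha>)"
    and a_0: "(a \<longlongrightarrow> a 0) (at_right 0)" and b_0: "(b \<longlongrightarrow> b 0) (at_right 0)"
  shows "\<exists>!w. \<forall>\<alpha>\<in>{0..1}. level w \<alpha> = {a \<alpha>..b \<alpha>}"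
proof (rule ex_ex1I)
  define L where "L t = insert 0 {\<alpha>\<in>{0..1}. t \<in> {a \<alpha>..b \<alpha>}}" for t
  define m where "m t = Sup (L t)" for t
  have bdd: "bdd_above (L t)" for t
    by (rule bdd_aboveI[of _ 1]) (auto simp: L_def)
  have m_in: "m t \<in> {0..1}" for t
  proof -
    have "0 \<le> m t" unfolding m_def by (rule cSup_upper[OF _ bdd]) (simp add: L_def)
    moreover have "m t \<le> 1" unfolding m_def by (rule cSup_least) (auto simp: L_def)
    ultimately show ?thesis by simp
  qed
  have m_ge: "m t \<ge> \<alpha> \<longleftrightarrow> t \<in> {a \<alpha>..b \<alpha>}" if al: "0 < \<alpha>" "\<alpha> \<le> 1" for t \<alpha>
  proof
    assume "t \<in> {a \<alpha>..b \<alpha>}"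
    then show "m t \<ge> \<alpha>"
      unfolding m_def using al by (intro cSup_upper[OF _ bdd]) (simp add: L_def)
  next
    assume mt: "m t \<ge> \<alpha>"
    have in_lev: "t \<in> {a \<beta>..b \<beta>}" if b: "0 < \<beta>" "\<beta> < \<alpha>" for \<beta>
    proof -
      have "\<exists>\<gamma>\<in>L t. \<beta> < \<gamma>"
        using mt that less_cSup_iff[OF _ bdd, of t \<beta>] unfolding m_def by (auto simp: L_def)
      then obtain \<gamma> where "\<beta> < \<gamma>" "\<gamma> \<le> 1" "t \<in> {a \<gamma>..b \<gamma>}"
        using b(1) by (fastforce simp: L_def)
      then show ?thesis using a_mono[of \<beta> \<gamma>] b_anti[of \<beta> \<gamma>] that by auto
    qed
    have ev: "\<forall>\<^sub>F \<beta> in at_left \<alpha>. a \<beta> \<le> t \<and> t \<le> b \<beta>"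
      using eventually_at_left_real[OF al(1)] by (rule eventually_mono) (use in_lev in auto)
    have "a \<alpha> \<le> t"
      by (rule tendsto_upperbound[OF a_left[OF al]])
         (use ev in \<open>auto elim: eventually_mono\<close>)
    moreover have "t \<le> b \<alpha>"
      by (rule tendsto_lowerbound[OF b_left[OF al]])
         (use ev in \<open>auto elim: eventually_mono\<close>)
    ultimately show "t \<in> {a \<alpha>..b \<alpha>}" by simp
  qed
  have ab': "a \<alpha> \<le> b \<alpha>" if "0 \<le> \<alpha>" "\<alpha> \<le> 1" for \<alpha>
    using a_mono[of \<alpha> 1] b_anti[of \<alpha> 1] ab that by auto
  have supp: "closure {t. m t > 0} = {a 0..b 0}"
  proof
    have "t \<in> {a 0..b 0}" if "m t > 0" for t
      using m_ge[of "m t" t] that m_in[of t] a_mono[of 0 "m t"] b_anti[of 0 "m t"] by auto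
    then show "closure {t. m t > 0} \<subseteq> {a 0..b 0}"
      by (intro closure_minimal) auto
    have pos: "{a \<beta>..b \<beta>} \<subseteq> {t. m t > 0}" if "0 < \<beta>" "\<beta> \<le> 1" for \<beta>
      using m_ge[of \<beta>] that by force
    have ev: "\<forall>\<^sub>F \<beta> in at_right 0. 0 < \<beta> \<and> \<beta> \<le> (1::real)"
      using eventually_at_right_real[OF zero_less_one] by (rule eventually_mono) auto
    show "{a 0..b 0} \<subseteq> closure {t. m t > 0}"
    proof
      fix t assume t: "t \<in> {a 0..b 0}"
      have "((\<lambda>\<beta>. max (a \<beta>) (min t (b \<beta>))) \<longlongrightarrow> max (a 0) (min t (b 0))) (at_right 0)"
        by (intro tendsto_intros a_0 b_0)
      moreover have "max (a 0) (min t (b 0)) = t" using t by auto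
      moreover have "\<forall>\<^sub>F \<beta> in at_right 0. max (a \<beta>) (min t (b \<beta>)) \<in> closure {t. m t > 0}"
        using ev
      proof eventually_elim
        case (elim \<beta>)
        then have "max (a \<beta>) (min t (b \<beta>)) \<in> {a \<beta>..b \<beta>}" using ab'[of \<beta>] by auto
        then show ?case using pos[of \<beta>] elim closure_subset[of "{t. m t > 0}"] by blast
      qed
      ultimately show "t \<in> closure {t. m t > 0}"
        using Lim_in_closed_set[OF closed_closure, of "\<lambda>\<beta>. max (a \<beta>) (min t (b \<beta>))"
            "{t. m t > 0}" "at_right 0" t]
        by (simp add: trivial_limit_at_right_real)
    qed
  qed
  have fz: "is_fuzzy_number m"
    unfolding is_fuzzy_number_def
  proof (intro conjI allI impI)
    show "range m \<subseteq> {0..1}" using m_in by auto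
    have "m (a 1) \<ge> 1" using m_ge[of 1 "a 1"] ab by simp
    then show "\<exists>t. m t = 1" using m_in[of "a 1"] by (intro exI[of _ "a 1"]) auto
    show "compact (closure {t. m t > 0})" unfolding supp by simp
  next
    fix t t' \<theta> :: real assume th: "0 \<le> \<theta> \<and> \<theta> \<le> 1"
    define c where "c = min (m t) (m t')"
    have c: "c \<le> m t" "c \<le> m t'" "c \<le> 1"
      using m_in[of t] by (auto simp: c_def)
    have "c \<le> m (\<theta> * t + (1 - \<theta>) * t')"
    proof (cases "c > 0")
      case True
      have "t \<in> {a c..b c}" "t' \<in> {a c..b c}"
        using m_ge[OF True c(3), THEN iffD1] c(1,2) by blast+
      then have "\<theta> *\<^sub>R t + (1 - \<theta>) *\<^sub>R t' \<in> {a c..b c}"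
        using th by (intro convexD[OF convex_real_interval(5)]) auto
      then show ?thesis using m_ge[OF True c(3), THEN iffD2] by simp
    next
      case False
      then show ?thesis using m_in[of "\<theta> * t + (1 - \<theta>) * t'"] by simp
    qed
    then show "min (m t) (m t') \<le> m (\<theta> * t + (1 - \<theta>) * t')"
      by (simp add: c_def)
  next
    fix t y assume ty: "m t < y"
    show "\<forall>\<^sub>F t' in nhds t. m t' < y"
    proof (cases "y > 1")
      case True
      then have "m t' < y" for t' using m_in[of t'] by auto
      then show ?thesis by simp
    next
      case False
      then have y: "0 < y" "y \<le> 1" using ty m_in[of t] by auto
      have "\<forall>\<^sub>F t' in nhds t. t' \<in> - {a y..b y}"
        using m_ge[OF y, of t] ty by (intro eventually_nhds_in_open) auto
      then show ?thesis
        by eventually_elim (use m_ge[OF y] in force)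
    qed
  qed
  have mem: "membership (Abs_fuzzy_number m) = m"
    using fz by (simp add: Abs_fuzzy_number_inverse)
  show "\<exists>w. \<forall>\<alpha>\<in>{0..1}. level w \<alpha> = {a \<alpha>..b \<alpha>}"
  proof (intro exI[of _ "Abs_fuzzy_number m"] ballI)
    fix \<alpha> :: real assume "\<alpha> \<in> {0..1}"
    then show "level (Abs_fuzzy_number m) \<alpha> = {a \<alpha>..b \<alpha>}"
      using supp m_ge[of \<alpha>] by (cases "\<alpha> = 0") (auto simp: level_def mem)
  qed
next
  fix v w
  assume "\<forall>\<alpha>\<in>{0..1}. level v \<alpha> = {a \<alpha>..b \<alpha>}" "\<forall>\<alpha>\<in>{0..1}. level w \<alpha> = {a \<alpha>..b \<alpha>}"
  then show "v = w" by (intro fuzzy_number_eqI) auto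
qed

section \<open>Levelwise operations\<close>

text \<open>
  Sums and scalar multiples are the unique fuzzy numbers with the prescribed level sets; existence
  and uniqueness are established in \<open>level_plus\<close> and \<open>level_scaleR\<close> below. Fuzzy numbers have no
  additive inverses, so only the syntactic class for \<^term>\<open>(*\<^sub>R)\<close> is instantiated.
\<close>

instantiation fuzzy_number :: "{zero, plus, scaleR}"
begin

definition zero_fuzzy_number :: fuzzy_number where
  "0 = Abs_fuzzy_number (\<lambda>t. if t = 0 then 1 else 0)"

definition plus_fuzzy_number :: "fuzzy_number \<Rightarrow> fuzzy_number \<Rightarrow> fuzzy_number" where
  "u + v = (THE w. \<forall>\<alpha>\<in>{0..1}. level w \<alpha> = {lower u \<alpha> + lower v \<alpha>..upper u \<alpha> + upper v \<alpha>})"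

definition scaleR_fuzzy_number :: "real \<Rightarrow> fuzzy_number \<Rightarrow> fuzzy_number" where
  "k *\<^sub>R u = (THE w. \<forall>\<alpha>\<in>{0..1}. level w \<alpha> =
     (if k \<ge> 0 then {k * lower u \<alpha>..k * upper u \<alpha>} else {k * upper u \<alpha>..k * lower u \<alpha>}))"

instance ..

end

lemma level_plus:
  assumes "\<alpha> \<in> {0..1}"
  shows "level (u + v) \<alpha> = {lower u \<alpha> + lower v \<alpha>..upper u \<alpha> + upper v \<alpha>}"
proof -
  have "\<exists>!w. \<forall>\<alpha>\<in>{0..1}. level w \<alpha> = {lower u \<alpha> + lower v \<alpha>..upper u \<alpha> + upper v \<alpha>}"
    by (rule ex_fuzzy_number_of_levels)
       (auto intro!: add_mono tendsto_add lower_upper_mono lower_upper_at_left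
          lower_upper_at_right_0 level_eq_interval)
  from theI'[OF this] assms show ?thesis by (simp add: plus_fuzzy_number_def)
qed

lemma level_scaleR:
  assumes "\<alpha> \<in> {0..1}"
  shows "level (k *\<^sub>R u) \<alpha> =
    (if k \<ge> 0 then {k * lower u \<alpha>..k * upper u \<alpha>} else {k * upper u \<alpha>..k * lower u \<alpha>})"
proof -
  have "\<exists>!w. \<forall>\<alpha>\<in>{0..1}. level w \<alpha> =
    (if k \<ge> 0 then {k * lower u \<alpha>..k * upper u \<alpha>} else {k * upper u \<alpha>..k * lower u \<alpha>})"
  proof (cases "k \<ge> 0")
    case True
    have "\<exists>!w. \<forall>\<alpha>\<in>{0..1}. level w \<alpha> = {k * lower u \<alpha>..k * upper u \<alpha>}"
      by (rule ex_fuzzy_number_of_levels)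
         (use True in \<open>auto intro!: mult_left_mono tendsto_mult_left lower_upper_mono
            lower_upper_at_left lower_upper_at_right_0 level_eq_interval\<close>)
    then show ?thesis using True by simp
  next
    case False
    have "\<exists>!w. \<forall>\<alpha>\<in>{0..1}. level w \<alpha> = {k * upper u \<alpha>..k * lower u \<alpha>}"
      by (rule ex_fuzzy_number_of_levels)
         (use False in \<open>auto intro!: mult_left_mono_neg tendsto_mult_left lower_upper_mono
            lower_upper_at_left lower_upper_at_right_0 level_eq_interval\<close>)
    then show ?thesis using False by simp
  qed
  from theI'[OF this] assms show ?thesis by (simp add: scaleR_fuzzy_number_def)
qed

lemma lower_upper_eqI:
  assumes "level u \<alpha> = {a..b}" "\<alpha> \<in> {0..1}"
  shows "lower u \<alpha> = a" "upper u \<alpha> = b"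
  using assms level_eq_interval[OF assms(2), of u] by auto

lemma lower_upper_plus:
  assumes "\<alpha> \<in> {0..1}"
  shows "lower (u + v) \<alpha> = lower u \<alpha> + lower v \<alpha>" "upper (u + v) \<alpha> = upper u \<alpha> + upper v \<alpha>"
  using lower_upper_eqI[OF level_plus[OF assms] assms] by auto

lemma level_zero_fuzzy_number:
  assumes "\<alpha> \<in> {0..1}"
  shows "level 0 \<alpha> = {0}"
proof -
  have "(\<lambda>t::real. if t = 0 then 1 else 0 :: real) = indicator {0}"
    by (auto simp: indicator_def)
  then have m: "membership 0 = (\<lambda>t. if t = 0 then 1 else 0)"
    using is_fuzzy_number_indicator[of 0]
    by (simp add: zero_fuzzy_number_def Abs_fuzzy_number_inverse)
  have "{t::real. (if t = 0 then 1 else 0 :: real) > 0} = {0}" by auto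
  then show ?thesis using assms by (auto simp: level_def m)
qed

lemma lower_upper_zero:
  assumes "\<alpha> \<in> {0..1}"
  shows "lower 0 \<alpha> = 0" "upper 0 \<alpha> = 0"
  using lower_upper_eqI[of 0 \<alpha> 0 0] level_zero_fuzzy_number[OF assms] assms by auto

instance fuzzy_number :: comm_monoid_add
proof
  fix u v w :: fuzzy_number
  show "u + v + w = u + (v + w)"
    by (rule fuzzy_number_eqI) (simp add: level_plus lower_upper_plus add.assoc)
  show "u + v = v + u"
    by (rule fuzzy_number_eqI) (simp add: level_plus add.commute)
  show "0 + u = u"
    by (rule fuzzy_number_eqI)
       (simp add: level_plus lower_upper_zero level_eq_interval(1)[of _ u])
qed

section \<open>The supremum metric\<close>

instantiation fuzzy_number :: metric_space
begin

definition dist_fuzzy_number :: "fuzzy_number \<Rightarrow> fuzzy_number \<Rightarrow> real" where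
  "dist u v =
     (SUP \<alpha>\<in>{0..1}. max \<bar>lower u \<alpha> - lower v \<alpha>\<bar> \<bar>upper u \<alpha> - upper v \<alpha>\<bar>)"

definition uniformity_fuzzy_number :: "(fuzzy_number \<times> fuzzy_number) filter" where
  "uniformity_fuzzy_number = (INF e\<in>{0<..}. principal {(u, v). dist u v < e})"

definition open_fuzzy_number :: "fuzzy_number set \<Rightarrow> bool" where
  "open_fuzzy_number U \<longleftrightarrow> (\<forall>u\<in>U. \<forall>\<^sub>F (u', v) in uniformity. u' = u \<longrightarrow> v \<in> U)"

lemma bdd_above_dist_fuzzy_number:
  "bdd_above ((\<lambda>\<alpha>. max \<bar>lower u \<alpha> - lower v \<alpha>\<bar> \<bar>upper u \<alpha> - upper v \<alpha>\<bar>) ` {0..1})"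
proof (rule bdd_aboveI2)
  fix \<alpha> :: real assume a: "\<alpha> \<in> {0..1}"
  have "lower w 0 \<le> lower w \<alpha>" "lower w \<alpha> \<le> upper w \<alpha>" "upper w \<alpha> \<le> upper w 0" for w
    using a lower_upper_mono[of 0 \<alpha> w] level_eq_interval[of \<alpha> w] by auto
  from this[of u] this[of v]
  show "max \<bar>lower u \<alpha> - lower v \<alpha>\<bar> \<bar>upper u \<alpha> - upper v \<alpha>\<bar>
      \<le> \<bar>lower u 0\<bar> + \<bar>lower v 0\<bar> + \<bar>upper u 0\<bar> + \<bar>upper v 0\<bar>"
    by linarith
qed

lemma dist_fuzzy_number_ge:
  assumes "\<alpha> \<in> {0..1}"
  shows "\<bar>lower u \<alpha> - lower v \<alpha>\<bar> \<le> dist u v" "\<bar>upper u \<alpha> - upper v \<alpha>\<bar> \<le> dist u v"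
  using cSUP_upper[OF assms bdd_above_dist_fuzzy_number[of u v]]
  by (auto simp: dist_fuzzy_number_def)

lemma dist_fuzzy_number_le:
  assumes "\<And>\<alpha>. \<alpha> \<in> {0..1} \<Longrightarrow> \<bar>lower u \<alpha> - lower v \<alpha>\<bar> \<le> c"
    and "\<And>\<alpha>. \<alpha> \<in> {0..1} \<Longrightarrow> \<bar>upper u \<alpha> - upper v \<alpha>\<bar> \<le> c"
  shows "dist u v \<le> c"
  unfolding dist_fuzzy_number_def by (rule cSUP_least) (use assms in auto)

instance
proof
  fix u v w :: fuzzy_number
  show "dist u v = 0 \<longleftrightarrow> u = v"
  proof
    assume "dist u v = 0"
    then have "lower u \<alpha> = lower v \<alpha>" "upper u \<alpha> = upper v \<alpha>" if "\<alpha> \<in> {0..1}" for \<alpha>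
      using dist_fuzzy_number_ge[OF that, of u v] by auto
    then show "u = v" by (intro fuzzy_number_eqI) (simp add: level_eq_interval)
  next
    assume "u = v"
    then show "dist u v = 0" by (simp add: dist_fuzzy_number_def)
  qed
  show "dist u v \<le> dist u w + dist v w"
  proof (rule dist_fuzzy_number_le)
    fix \<alpha> :: real assume a: "\<alpha> \<in> {0..1}"
    show "\<bar>lower u \<alpha> - lower v \<alpha>\<bar> \<le> dist u w + dist v w"
      using dist_fuzzy_number_ge(1)[OF a, of u w] dist_fuzzy_number_ge(1)[OF a, of v w] by linarith
    show "\<bar>upper u \<alpha> - upper v \<alpha>\<bar> \<le> dist u w + dist v w"
      using dist_fuzzy_number_ge(2)[OF a, of u w] dist_fuzzy_number_ge(2)[OF a, of v w] by linarith
  qed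
qed (simp_all add: uniformity_fuzzy_number_def open_fuzzy_number_def)

end

section \<open>Summability by generalized Dirichlet series\<close>

text \<open>
  \<^term>\<open>summable\<close>, \<^term>\<open>suminf\<close> and the limit all refer to the topology of the metric above.
\<close>

definition A_summable ::
    "(nat \<Rightarrow> real) \<Rightarrow> (nat \<Rightarrow> fuzzy_number) \<Rightarrow> fuzzy_number \<Rightarrow> bool" where
  "A_summable l u \<mu> \<longleftrightarrow>
     (\<forall>s>0. summable (\<lambda>n. exp (- l n * s) *\<^sub>R u n)) \<and>
     ((\<lambda>s. \<Sum>n. exp (- l n * s) *\<^sub>R u n) \<longlongrightarrow> \<mu>) (at_right 0)"

end

theory Submission
  imports Defs
begin

text \<open>
  This is Tauber's classical argument with \<open>s = 1 / l N\<close>. Comparing \<open>\<Sum>n\<le>N. u n\<close> with the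
  Dirichlet series at \<open>s\<close> termwise costs \<open>(1 - exp (- l n * s)) * dist (u n) 0\<close> for \<open>n \<le> N\<close>, where
  \<open>1 - exp (- x) \<le> x\<close> leaves a weighted Cesaro mean of the null sequence from the hypothesis, and
  \<open>exp (- l n * s) * dist (u n) 0\<close> for \<open>n > N\<close>, where
  \<open>(l (n + 1) - l n) * exp (- l (n + 1) * s)\<close> is dominated by a telescoping sum.
\<close>

text \<open>Without subtraction, errors cannot be measured as norms of differences. This
  subadditivity of the metric replaces that and comes from the triangle inequality at each
  endpoint.\<close>

lemma dist_fuzzy_number_add_le:
  fixes a b c d :: fuzzy_number
  shows "dist (a + b) (c + d) \<le> dist a c + dist b d"
proof (rule dist_fuzzy_number_le)
  fix \<alpha> :: real assume \<alpha>: "\<alpha> \<in> {0..1}"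
  show "\<bar>lower (a + b) \<alpha> - lower (c + d) \<alpha>\<bar> \<le> dist a c + dist b d"
    using dist_fuzzy_number_ge(1)[OF \<alpha>, of a c] dist_fuzzy_number_ge(1)[OF \<alpha>, of b d]
    by (simp add: lower_upper_plus[OF \<alpha>])
  show "\<bar>upper (a + b) \<alpha> - upper (c + d) \<alpha>\<bar> \<le> dist a c + dist b d"
    using dist_fuzzy_number_ge(2)[OF \<alpha>, of a c] dist_fuzzy_number_ge(2)[OF \<alpha>, of b d]
    by (simp add: lower_upper_plus[OF \<alpha>])
qed

lemma dist_fuzzy_number_sum_le:
  fixes f g :: "'a \<Rightarrow> fuzzy_number"
  shows "dist (sum f A) (sum g A) \<le> (\<Sum>i\<in>A. dist (f i) (g i))"
proof (induction A rule: infinite_finite_induct)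
  case (insert x A)
  then show ?case
    using dist_fuzzy_number_add_le[of "f x" "sum f A" "g x" "sum g A"] by simp
qed simp_all

lemma lower_upper_scaleR:
  assumes "\<alpha> \<in> {0..1}" "0 \<le> k"
  shows "lower (k *\<^sub>R u) \<alpha> = k * lower u \<alpha>" "upper (k *\<^sub>R u) \<alpha> = k * upper u \<alpha>"
  using lower_upper_eqI[OF _ assms(1)] level_scaleR[OF assms(1), of k u] assms(2) by auto

text \<open>Here \<open>scaleR\<close> is purely syntactic, so its laws are proved by hand. This one
  and the next allow a truncated sum to be written with weights 1 and 0.\<close>

lemma fuzzy_number_scaleR_one: "1 *\<^sub>R u = (u :: fuzzy_number)"
  by (rule fuzzy_number_eqI) (simp add: level_scaleR level_eq_interval(1)[of _ u])

lemma fuzzy_number_scaleR_zero: "0 *\<^sub>R u = (0 :: fuzzy_number)"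
  by (rule fuzzy_number_eqI) (simp add: level_scaleR level_zero_fuzzy_number)

text \<open>Nonnegative scalars do not swap endpoints, so endpoints differ by \<open>j - k\<close>
  times an endpoint of \<open>u\<close>, which \<open>dist u 0\<close> bounds.\<close>

lemma dist_fuzzy_number_scaleR_le:
  fixes u :: fuzzy_number
  assumes "0 \<le> j" "0 \<le> k"
  shows "dist (j *\<^sub>R u) (k *\<^sub>R u) \<le> \<bar>j - k\<bar> * dist u 0"
proof (rule dist_fuzzy_number_le)
  fix \<alpha> :: real assume \<alpha>: "\<alpha> \<in> {0..1}"
  have "\<bar>lower u \<alpha>\<bar> \<le> dist u 0" "\<bar>upper u \<alpha>\<bar> \<le> dist u 0"
    using dist_fuzzy_number_ge[OF \<alpha>, of u 0] by (simp_all add: lower_upper_zero[OF \<alpha>])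
  then have "\<bar>j - k\<bar> * \<bar>lower u \<alpha>\<bar> \<le> \<bar>j - k\<bar> * dist u 0"
    "\<bar>j - k\<bar> * \<bar>upper u \<alpha>\<bar> \<le> \<bar>j - k\<bar> * dist u 0"
    by (auto intro: mult_left_mono)
  then show "\<bar>lower (j *\<^sub>R u) \<alpha> - lower (k *\<^sub>R u) \<alpha>\<bar> \<le> \<bar>j - k\<bar> * dist u 0"
    "\<bar>upper (j *\<^sub>R u) \<alpha> - upper (k *\<^sub>R u) \<alpha>\<bar> \<le> \<bar>j - k\<bar> * dist u 0"
    using assms by (simp_all add: lower_upper_scaleR[OF \<alpha>] flip: abs_mult left_diff_distrib)
qed

text \<open>The right side is the integral of \<open>exp (- t * s)\<close> over \<open>t\<close>
  from \<open>a\<close> to \<open>b\<close>. The estimate is \<open>1 + x \<le> exp x\<close> at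
  \<open>x = (b - a) * s\<close>.\<close>

lemma diff_mult_exp_le:
  fixes a b s :: real
  assumes "0 < s"
  shows "(b - a) * exp (- b * s) \<le> (exp (- a * s) - exp (- b * s)) / s"
proof -
  have "1 + (b - a) * s \<le> exp ((b - a) * s)" by simp
  then have "(1 + (b - a) * s) * exp (- b * s) \<le> exp ((b - a) * s) * exp (- b * s)"
    by (rule mult_right_mono) simp
  also have "\<dots> = exp (- a * s)"
    by (simp add: algebra_simps flip: exp_add)
  finally show ?thesis
    using assms by (simp add: field_simps)
qed

text \<open>The bound is free of \<open>M\<close>, so it survives passing from partial sums to the
  whole series.\<close>

lemma sum_diff_mult_exp_le:
  fixes l :: "nat \<Rightarrow> real"
  assumes "0 < s" "N \<le> M"
  shows "(\<Sum>n=N..<M. (l (Suc n) - l n) * exp (- l (Suc n) * s)) \<le> exp (- l N * s) / s"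
proof -
  have "(\<Sum>n=N..<M. (l (Suc n) - l n) * exp (- l (Suc n) * s))
      \<le> (\<Sum>n=N..<M. (exp (- l n * s) - exp (- l (Suc n) * s)) / s)"
    by (intro sum_mono diff_mult_exp_le assms)
  also have "\<dots> = (exp (- l N * s) - exp (- l M * s)) / s"
    using sum_Suc_diff'[OF assms(2), of "\<lambda>n. - exp (- l n * s)"]
    by (simp add: algebra_simps flip: sum_divide_distrib)
  also have "\<dots> \<le> exp (- l N * s) / s"
    using assms(1) by (simp add: divide_right_mono)
  finally show ?thesis .
qed

text \<open>Once \<open>e n < r / 2\<close>, each further term adds at most \<open>r / 2\<close>
  times the increment of \<open>l\<close>. The finitely many earlier terms contribute a constant,
  negligible against \<open>l N\<close>.\<close>

lemma weighted_cesaro_null: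
  fixes l e :: "nat \<Rightarrow> real"
  assumes "mono l" "filterlim l at_top sequentially" "e \<longlonglongrightarrow> 0" "\<And>n. 0 \<le> e n"
  shows "(\<lambda>N. (\<Sum>n<N. e n * (l (Suc n) - l n)) / l N) \<longlonglongrightarrow> 0"
proof (rule LIMSEQ_I)
  fix r :: real assume r: "0 < r"
  have \<Delta>: "0 \<le> l (Suc n) - l n" for n
    using monoD[OF assms(1), of n "Suc n"] by simp
  obtain K where K: "\<And>n. n \<ge> K \<Longrightarrow> e n < r / 2"
    using order_tendstoD(2)[OF assms(3), of "r / 2"] r by (auto simp: eventually_sequentially)
  \<comment> \<open>Chosen so that the next bound is an equality at \<open>N = K\<close>, the base
    of the induction.\<close>
  define C where "C = (\<Sum>n<K. e n * (l (Suc n) - l n)) - r / 2 * l K"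
  have le: "(\<Sum>n<N. e n * (l (Suc n) - l n)) \<le> C + r / 2 * l N" if "K \<le> N" for N
    using that
  proof (induction N rule: dec_induct)
    case base
    then show ?case by (simp add: C_def)
  next
    case (step n)
    have "e n * (l (Suc n) - l n) \<le> r / 2 * (l (Suc n) - l n)"
      using K[of n] step.hyps \<Delta> by (intro mult_right_mono) auto
    then show ?case using step.IH by (simp add: algebra_simps)
  qed
  \<comment> \<open>The 1 keeps the divisor positive; the other entry makes \<open>C\<close>
    strictly less than \<open>r / 2 * l N\<close>.\<close>
  have "\<forall>\<^sub>F N in sequentially. max 1 (2 * C / r + 1) \<le> l N"
    using assms(2) unfolding filterlim_at_top by blast
  then obtain N0 where N0: "\<And>N. N \<ge> N0 \<Longrightarrow> max 1 (2 * C / r + 1) \<le> l N"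
    by (auto simp: eventually_sequentially)
  show "\<exists>N0. \<forall>N\<ge>N0. norm ((\<Sum>n<N. e n * (l (Suc n) - l n)) / l N - 0) < r"
  proof (intro exI allI impI)
    fix N assume N: "max K N0 \<le> N"
    then have l: "1 \<le> l N" "2 * C / r < l N" using N0[of N] by auto
    then have "C < r / 2 * l N" using r by (simp add: field_simps)
    then have "(\<Sum>n<N. e n * (l (Suc n) - l n)) < r * l N"
      using le[of N] N by simp
    moreover have "0 \<le> (\<Sum>n<N. e n * (l (Suc n) - l n))"
      by (intro sum_nonneg mult_nonneg_nonneg assms \<Delta>)
    ultimately show "norm ((\<Sum>n<N. e n * (l (Suc n) - l n)) / l N - 0) < r"
      using l by (simp add: field_simps)
  qed
qed

text \<open>Subadditivity of the metric handles finite sums only, so the Dirichlet series is cut at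
  \<open>M\<close>; the bound does not depend on \<open>M\<close>.\<close>

lemma dist_sum_dirichlet_partial_sum_le:
  fixes l :: "nat \<Rightarrow> real" and u :: "nat \<Rightarrow> fuzzy_number"
  assumes l0: "0 \<le> l 0" and "mono l" and lN: "0 < l N" and s: "0 < s" and "N \<le> M"
    and \<epsilon>: "\<And>n. N \<le> n \<Longrightarrow> l (Suc n) * dist (u (Suc n)) 0 \<le> \<epsilon> * (l (Suc n) - l n)" "0 \<le> \<epsilon>"
  shows "dist (\<Sum>n\<le>N. u n) (\<Sum>n\<le>M. exp (- l n * s) *\<^sub>R u n)
    \<le> s * (\<Sum>n\<le>N. l n * dist (u n) 0) + \<epsilon> / (s * l N)"
proof -
  \<comment> \<open>These weights extend the sum up to \<open>N\<close> to the index range of the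
    other sum, as termwise comparison requires.\<close>
  let ?c = "\<lambda>n. if n \<le> N then 1 else 0 :: real"
  let ?d = "\<lambda>n. dist (?c n *\<^sub>R u n) (exp (- l n * s) *\<^sub>R u n)"
  have lnn: "0 \<le> l n" for n using l0 monoD[OF \<open>mono l\<close>, of 0 n] by simp
  have split: "{..M} = {..N} \<union> {Suc N..<Suc M}" using \<open>N \<le> M\<close> by auto
  \<comment> \<open>Polymorphic because it splits both sums of fuzzy numbers and real sums of
    distances.\<close>
  have sum_split: "sum f {..M} = sum f {..N} + (\<Sum>n=N..<M. f (Suc n))"
    for f :: "nat \<Rightarrow> 'a :: comm_monoid_add"
    unfolding split by (subst sum.union_disjoint) (auto simp: sum.shift_bounds_Suc_ivl simp del: sum.op_ivl_Suc)
  have head: "?d n \<le> s * (l n * dist (u n) 0)" if "n \<le> N" for n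
  proof -
    have "?d n \<le> \<bar>1 - exp (- l n * s)\<bar> * dist (u n) 0"
      using dist_fuzzy_number_scaleR_le[of 1 "exp (- l n * s)" "u n"] that by simp
    also have "\<bar>1 - exp (- l n * s)\<bar> \<le> l n * s"
      using exp_ge_add_one_self[of "- l n * s"] lnn[of n] s by simp
    finally show ?thesis by (simp add: mult_ac mult_right_mono)
  qed
  have tail: "?d (Suc n) \<le> \<epsilon> / l N * ((l (Suc n) - l n) * exp (- l (Suc n) * s))" if "N \<le> n" for n
  proof -
    \<comment> \<open>Lowering \<open>l (Suc n)\<close> to the fixed \<open>l N\<close> leaves the
      gap \<open>l (Suc n) - l n\<close> as the only varying factor, ready for telescoping.\<close>
    have "l N * dist (u (Suc n)) 0 \<le> l (Suc n) * dist (u (Suc n)) 0"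
      using monoD[OF \<open>mono l\<close>, of N "Suc n"] that by (intro mult_right_mono) auto
    also note \<epsilon>(1)[OF that]
    finally have d: "dist (u (Suc n)) 0 \<le> \<epsilon> / l N * (l (Suc n) - l n)"
      using lN by (simp add: field_simps)
    have "?d (Suc n) \<le> exp (- l (Suc n) * s) * dist (u (Suc n)) 0"
      using dist_fuzzy_number_scaleR_le[of 0 "exp (- l (Suc n) * s)" "u (Suc n)"] that by simp
    also have "\<dots> \<le> exp (- l (Suc n) * s) * (\<epsilon> / l N * (l (Suc n) - l n))"
      using d by (rule mult_left_mono) simp
    finally show ?thesis by (simp add: mult_ac)
  qed
  have "(\<Sum>n\<le>N. u n) = (\<Sum>n\<le>M. ?c n *\<^sub>R u n)"
    by (simp add: sum_split fuzzy_number_scaleR_one fuzzy_number_scaleR_zero)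
  then have "dist (\<Sum>n\<le>N. u n) (\<Sum>n\<le>M. exp (- l n * s) *\<^sub>R u n) \<le> (\<Sum>n\<le>M. ?d n)"
    using dist_fuzzy_number_sum_le[of "\<lambda>n. ?c n *\<^sub>R u n" "{..M}"] by simp
  also have "\<dots> = (\<Sum>n\<le>N. ?d n) + (\<Sum>n=N..<M. ?d (Suc n))"
    by (rule sum_split)
  also have "(\<Sum>n\<le>N. ?d n) \<le> s * (\<Sum>n\<le>N. l n * dist (u n) 0)"
    unfolding sum_distrib_left by (intro sum_mono head) auto
  also have "(\<Sum>n=N..<M. ?d (Suc n))
      \<le> (\<Sum>n=N..<M. \<epsilon> / l N * ((l (Suc n) - l n) * exp (- l (Suc n) * s)))"
    by (intro sum_mono tail) auto
  also have "\<dots> \<le> \<epsilon> / l N * (exp (- l N * s) / s)"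
    unfolding sum_distrib_left[symmetric] using \<epsilon>(2) lN
    by (intro mult_left_mono sum_diff_mult_exp_le s \<open>N \<le> M\<close>) auto
  also have "\<dots> \<le> \<epsilon> / l N * (1 / s)"
    using \<epsilon>(2) lN s by (intro mult_left_mono divide_right_mono) auto
  finally show ?thesis by (simp add: mult.commute)
qed

theorem theorem3p4:
  fixes l :: "nat \<Rightarrow> real" and u :: "nat \<Rightarrow> fuzzy_number" and \<mu> :: fuzzy_number
  assumes "0 \<le> l 0" and "strict_mono l" and "filterlim l at_top sequentially"
    and "A_summable l u \<mu>"
    and "(\<lambda>n. l (Suc n) / (l (Suc n) - l n) * dist (u (Suc n)) 0) \<in> o(\<lambda>_. 1)"
  shows "u sums \<mu>"
proof -
  \<comment> \<open>Index \<open>n\<close> belongs to term \<open>Suc n\<close>, as term 0 has no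
    preceding gap; that term is split off from \<open>T\<close> below.\<close>
  define e where "e n = l (Suc n) / (l (Suc n) - l n) * dist (u (Suc n)) 0" for n
  define A where "A s = (\<Sum>n. exp (- l n * s) *\<^sub>R u n)" for s
  define T where "T N = (\<Sum>n\<le>N. l n * dist (u n) 0) / l N" for N
  have mono: "mono l" using assms(2) by (rule strict_mono_mono)
  have \<Delta>: "0 < l (Suc n) - l n" for n using strict_monoD[OF assms(2), of n "Suc n"] by simp
  have lnn: "0 \<le> l n" for n using assms(1) monoD[OF mono, of 0 n] by simp
  have e0: "e \<longlonglongrightarrow> 0"
    using smalloD_tendsto[OF assms(5)] by (simp add: e_def[abs_def])
  have e_nonneg: "0 \<le> e n" for n
    using \<Delta>[of n] lnn[of "Suc n"] by (simp add: e_def)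
  have e_mult: "l (Suc n) * dist (u (Suc n)) 0 = e n * (l (Suc n) - l n)" for n
    using \<Delta>[of n] by (simp add: e_def)
  have "T = (\<lambda>N. l 0 * dist (u 0) 0 / l N + (\<Sum>n<N. e n * (l (Suc n) - l n)) / l N)"
    by (simp add: fun_eq_iff T_def sum.atMost_shift e_mult add_divide_distrib)
  moreover have "(\<lambda>N. l 0 * dist (u 0) 0 / l N) \<longlonglongrightarrow> 0"
    by (rule real_tendsto_divide_at_top[OF tendsto_const assms(3)])
  ultimately have T0: "T \<longlonglongrightarrow> 0"
    using tendsto_add[OF _ weighted_cesaro_null[OF mono assms(3) e0 e_nonneg]] by fastforce
  \<comment> \<open>Only eventually, since \<open>l 0\<close> may be 0.\<close>
  have l_pos: "\<forall>\<^sub>F N in sequentially. 0 < l N"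
    using assms(3) by (simp add: filterlim_at_top_dense)
  have "filterlim (\<lambda>N. 1 / l N) (at_right 0) sequentially"
    unfolding filterlim_at using l_pos
    by (auto intro!: real_tendsto_divide_at_top[OF tendsto_const assms(3)] elim: eventually_mono)
  moreover have "(A \<longlongrightarrow> \<mu>) (at_right 0)"
    using assms(4) by (simp add: A_summable_def A_def[abs_def])
  ultimately have A_lim: "(\<lambda>N. A (1 / l N)) \<longlonglongrightarrow> \<mu>"
    by (rule filterlim_compose[rotated])
  have "(\<lambda>N. dist (\<Sum>n\<le>N. u n) (A (1 / l N))) \<longlonglongrightarrow> 0"
  proof (rule tendstoI)
    fix r :: real assume r: "0 < r"
    have "\<forall>\<^sub>F N in sequentially. \<forall>n\<ge>N. e n < r / 2" "\<forall>\<^sub>F N in sequentially. T N < r / 2"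
      using order_tendstoD(2)[OF e0, of "r / 2"] order_tendstoD(2)[OF T0, of "r / 2"] r
      by (auto intro: eventually_all_ge_at_top)
    with l_pos show "\<forall>\<^sub>F N in sequentially. dist (dist (\<Sum>n\<le>N. u n) (A (1 / l N))) 0 < r"
    proof eventually_elim
      case (elim N)
      let ?D = "\<lambda>M. \<Sum>n\<le>M. exp (- l n * (1 / l N)) *\<^sub>R u n"
      have "0 < 1 / l N" using elim by simp
      then have "summable (\<lambda>n. exp (- l n * (1 / l N)) *\<^sub>R u n)"
        using assms(4) unfolding A_summable_def by blast
      then have "?D \<longlonglongrightarrow> A (1 / l N)"
        unfolding A_def sums_def_le[symmetric] by (rule summable_sums)
      then have "(\<lambda>M. dist (\<Sum>n\<le>N. u n) (?D M)) \<longlonglongrightarrow> dist (\<Sum>n\<le>N. u n) (A (1 / l N))"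
        by (intro tendsto_dist tendsto_const)
      \<comment> \<open>With \<open>s = 1 / l N\<close> and \<epsilon> equal to
        \<open>r / 2\<close>, the head bound becomes \<open>T N\<close> and the tail bound
        \<open>r / 2\<close>, uniformly in \<open>M\<close>.\<close>
      moreover have "dist (\<Sum>n\<le>N. u n) (?D M) \<le> T N + r / 2" if "N \<le> M" for M
      proof -
        have "l (Suc n) * dist (u (Suc n)) 0 \<le> r / 2 * (l (Suc n) - l n)" if "N \<le> n" for n
          unfolding e_mult using elim that \<Delta>[of n] by (intro mult_right_mono) auto
        from dist_sum_dirichlet_partial_sum_le[OF assms(1) mono _ _ \<open>N \<le> M\<close> this, of "1 / l N"]
        show ?thesis using elim r by (simp add: T_def)
      qed
      ultimately have "dist (\<Sum>n\<le>N. u n) (A (1 / l N)) \<le> T N + r / 2"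
        by (intro LIMSEQ_le_const2) blast+
      then show ?case using elim by simp
    qed
  qed
  moreover have "(\<lambda>N. dist (A (1 / l N)) \<mu>) \<longlonglongrightarrow> 0"
    using A_lim by (rule tendsto_dist_iff[THEN iffD1])
  ultimately have "(\<lambda>N. dist (\<Sum>n\<le>N. u n) (A (1 / l N)) + dist (A (1 / l N)) \<mu>) \<longlonglongrightarrow> 0"
    by (rule tendsto_add_zero)
  then have "(\<lambda>N. dist (\<Sum>n\<le>N. u n) \<mu>) \<longlonglongrightarrow> 0"
    by (rule metric_tendsto_imp_tendsto) (simp add: dist_triangle)
  then show ?thesis
    unfolding sums_def_le by (rule tendsto_dist_iff[THEN iffD2])
qed

end
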